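(* Let $B$ be a central simple division algebra over a field $F$ with (reduced) norm $N_{B/F}:B\to F$, let $\sigma\in\mathrm{Aut}_F(B)$ be a non-trivial automorphism and let $c\in B^{\times}$. If $N_{B/F}(c)\neq N_{B/F}(a)^2$ for all $a\in B$, then the algebras $D(B,\sigma,c)$, $D_m(B,\sigma,c)$ and $D_r(B,\sigma,c)$ are division algebras.
   Context: $D(B,\sigma,c)$, $D_m(B,\sigma,c)$ and $D_r(B,\sigma,c)$ denote the $F$-vector space $B\oplus B$ endowed, respectively, with the multiplications $(u,v)(x,y)=(ux+c\,\sigma(vy),\,uy+vx)$, $(u,v)(x,y)=(ux+\sigma(v)c\,\sigma(y),\,uy+vx)$, $(u,v)(x,y)=(ux+\sigma(vy)c,\,uy+vx)$, for $u,v,x,y\in B$. A finite-dimensional (nonassociative) $F$-algebra $A$ is a division algebra if for every nonzero $a\in A$ the maps $x\mapsto ax$ and $x\mapsto xa$ are bijective; equivalently, $A$ has no zero divisors. The norm $N_{B/F}$ is multiplicative, of degree equal to the degree of $B$, and nondegenerate in the sense that $N_{B/F}(x)=0$ if and only if $x=0$. *)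

theory Defs
  imports
    "HOL-Analysis.Product_Vector"
    "HOL-Algebra.Algebraic_Closure_Type"
    "Jordan_Normal_Form.Determinant"
begin

text \<open>
  A finite-dimensional algebra over a field, not assumed associative or unital: its multiplication
  is an arbitrary bilinear map.
\<close>

locale finite_dim_algebra = vector_space smul
  for smul :: "'f::field \<Rightarrow> 'a::ab_group_add \<Rightarrow> 'a" +
  fixes mult :: "'a \<Rightarrow> 'a \<Rightarrow> 'a"
  assumes finite_dim: "\<exists>E. finite_dimensional_vector_space smul E"
    and linear_mult_right: "\<And>x. Vector_Spaces.linear smul smul (\<lambda>y. mult x y)"
    and linear_mult_left: "\<And>y. Vector_Spaces.linear smul smul (\<lambda>x. mult x y)"

locale division_algebra = finite_dim_algebra +
  assumes bij_mult_left: "\<And>a. a \<noteq> 0 \<Longrightarrow> bij (\<lambda>x. mult a x)"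
    and bij_mult_right: "\<And>a. a \<noteq> 0 \<Longrightarrow> bij (\<lambda>x. mult x a)"

definition two_sided_ideal :: "'b::ring_1 set \<Rightarrow> bool" where
  "two_sided_ideal I \<longleftrightarrow>
     0 \<in> I \<and> (\<forall>x\<in>I. \<forall>y\<in>I. x + y \<in> I) \<and> (\<forall>a. \<forall>x\<in>I. a * x \<in> I \<and> x * a \<in> I)"

text \<open>Associativity, the unit and \<open>0 \<noteq> 1\<close> come from the class \<^class>\<open>ring_1\<close>.\<close>

locale central_simple_algebra = finite_dim_algebra smul "(*)"
  for smul :: "'f::field \<Rightarrow> 'b::ring_1 \<Rightarrow> 'b" +
  assumes central: "{z. \<forall>x. z * x = x * z} = range (\<lambda>a. smul a 1)"
    and simple: "\<And>I :: 'b set. two_sided_ideal I \<Longrightarrow> I = {0} \<or> I = UNIV"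

definition algebra_automorphism ::
  "('f::field \<Rightarrow> 'b::ring_1 \<Rightarrow> 'b) \<Rightarrow> ('b \<Rightarrow> 'b) \<Rightarrow> bool" where
  "algebra_automorphism smul \<sigma> \<longleftrightarrow>
     bij \<sigma> \<and> Vector_Spaces.linear smul smul \<sigma> \<and> \<sigma> 1 = 1 \<and> (\<forall>x y. \<sigma> (x * y) = \<sigma> x * \<sigma> y)"

text \<open>
  Let \<open>K\<close> be the algebraic closure of \<open>F\<close>. A splitting of \<open>B\<close> of degree \<open>n\<close> is a homomorphism of
  \<open>F\<close>-algebras \<open>\<phi> : B \<rightarrow> M\<^sub>n(K)\<close> such that the induced map \<open>B \<otimes>\<^sub>F K \<rightarrow> M\<^sub>n(K)\<close>, \<open>b \<otimes> k \<mapsto> k \<phi>(b)\<close>,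
  is bijective. An \<open>F\<close>-basis \<open>E\<close> of \<open>B\<close> identifies \<open>B \<otimes>\<^sub>F K\<close> with the coefficient
  families \<open>E \<rightarrow> K\<close>, and the induced map then sends \<open>k\<close> to \<open>\<Sum>e\<in>E. k(e) \<phi>(e)\<close>.
\<close>

definition splitting ::
  "('f::field \<Rightarrow> 'b::ring_1 \<Rightarrow> 'b) \<Rightarrow> nat \<Rightarrow> ('b \<Rightarrow> 'f alg_closure mat) \<Rightarrow> bool" where
  "splitting smul n \<phi> \<longleftrightarrow>
     (\<forall>x. \<phi> x \<in> carrier_mat n n) \<and>
     (\<forall>x y. \<phi> (x + y) = \<phi> x + \<phi> y) \<and>
     (\<forall>a x. \<phi> (smul a x) = to_ac a \<cdot>\<^sub>m \<phi> x) \<and>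
     (\<forall>x y. \<phi> (x * y) = \<phi> x * \<phi> y) \<and>
     \<phi> 1 = 1\<^sub>m n \<and>
     (\<exists>E. finite_dimensional_vector_space smul E \<and>
       bij_betw (\<lambda>k. mat n n (\<lambda>(i, j). \<Sum>e\<in>E. k e * \<phi> e $$ (i, j)))
         (E \<rightarrow>\<^sub>E UNIV) (carrier_mat n n))"

text \<open>
  The reduced norm is the determinant of a splitting; it takes values in \<open>F\<close>, embedded in its
  algebraic closure by \<^const>\<open>to_ac\<close>, and does not depend on the splitting.
\<close>

definition is_reduced_norm ::
  "('f::field \<Rightarrow> 'b::ring_1 \<Rightarrow> 'b) \<Rightarrow> ('b \<Rightarrow> 'f) \<Rightarrow> bool" where
  "is_reduced_norm smul N \<longleftrightarrow>
     (\<exists>n \<phi>. splitting smul n \<phi> \<and> (\<forall>x. to_ac (N x) = det (\<phi> x)))"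

definition mult_D :: "('b::ring_1 \<Rightarrow> 'b) \<Rightarrow> 'b \<Rightarrow> 'b \<times> 'b \<Rightarrow> 'b \<times> 'b \<Rightarrow> 'b \<times> 'b" where
  "mult_D \<sigma> c = (\<lambda>(u, v) (x, y). (u * x + c * \<sigma> (v * y), u * y + v * x))"

definition mult_D\<^sub>m :: "('b::ring_1 \<Rightarrow> 'b) \<Rightarrow> 'b \<Rightarrow> 'b \<times> 'b \<Rightarrow> 'b \<times> 'b \<Rightarrow> 'b \<times> 'b" where
  "mult_D\<^sub>m \<sigma> c = (\<lambda>(u, v) (x, y). (u * x + \<sigma> v * c * \<sigma> y, u * y + v * x))"

definition mult_D\<^sub>r :: "('b::ring_1 \<Rightarrow> 'b) \<Rightarrow> 'b \<Rightarrow> 'b \<times> 'b \<Rightarrow> 'b \<times> 'b \<Rightarrow> 'b \<times> 'b" where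
  "mult_D\<^sub>r \<sigma> c = (\<lambda>(u, v) (x, y). (u * x + \<sigma> (v * y) * c, u * y + v * x))"

end

theory Submission
  imports Defs
begin

text \<open>
  A zero divisor \<open>(u,v)(x,y) = 0\<close> with \<open>y \<noteq> 0\<close> satisfies \<open>u = - v w\<close> with \<open>w = x y\<^sup>-\<^sup>1\<close>, so the first
  component says that \<open>v w\<^sup>2 y\<close> equals \<open>c \<sigma>(v y)\<close> (or the corresponding middle or right term).
  As \<open>N \<circ> \<sigma> = N\<close>, taking norms gives \<open>N(c) = N(w)\<^sup>2\<close> unless \<open>v = 0\<close>.

  The invariance \<open>N \<circ> \<sigma> = N\<close> holds because \<open>\<sigma>\<close> is inner. For this instance of the Skolem-Noether
  theorem, fix a basis \<open>E\<close>. Every linear endomorphism of a central division algebra has the form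
  \<open>y \<mapsto> \<Sum>e\<in>E. g e * y * e\<close> (a density argument), with unique coefficients; comparing those of
  \<open>y \<mapsto> \<sigma> (x * y)\<close> and \<open>y \<mapsto> \<sigma> x * \<sigma> y\<close> gives \<open>\<sigma> x * g e = g e * x\<close>, and some \<open>g e\<close> is nonzero.
\<close>

section \<open>Finite-dimensional algebras without zero divisors\<close>

context finite_dim_algebra
begin

lemma
  shows mult_add_right: "mult x (y + z) = mult x y + mult x z"
    and mult_scale_right: "mult x (smul r y) = smul r (mult x y)"
    and mult_add_left: "mult (x + y) z = mult x z + mult y z"
    and mult_scale_left: "mult (smul r x) z = smul r (mult x z)"
  using linear_mult_right[of x] linear_mult_left[of z]
  by (auto simp: Vector_Spaces.linear_iff)

lemma
  shows mult_zero_right: "mult x 0 = 0"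
    and mult_zero_left: "mult 0 x = 0"
  using mult_scale_right[of x 0 0] mult_scale_left[of 0 0 x] by simp_all

lemma
  shows mult_diff_right: "mult x (y - z) = mult x y - mult x z"
    and mult_diff_left: "mult (x - y) z = mult x z - mult y z"
  using mult_add_right[of x "y - z" z] mult_add_left[of "x - y" y z] by (simp_all add: algebra_simps)

text \<open>Without zero divisors, multiplication by a nonzero element is an injective linear map,
  and finite dimension makes it surjective.\<close>

lemma division_algebraI:
  assumes "\<And>x y. mult x y = 0 \<Longrightarrow> x = 0 \<or> y = 0"
  shows "division_algebra smul mult"
proof -
  obtain E where "finite_dimensional_vector_space smul E"
    using finite_dim by blast
  then interpret fd: finite_dimensional_vector_space smul E .
  show ?thesis
  proof
    fix a :: 'a assume "a \<noteq> 0"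
    have "inj (\<lambda>x. mult a x)"
    proof (rule injI)
      fix x y assume "mult a x = mult a y"
      then have "mult a (x - y) = 0" by (simp add: mult_diff_right)
      with assms \<open>a \<noteq> 0\<close> show "x = y" by fastforce
    qed
    then show "bij (\<lambda>x. mult a x)"
      using fd.linear_inj_imp_surj[OF linear_mult_right] by (simp add: bij_def)
    have "inj (\<lambda>x. mult x a)"
    proof (rule injI)
      fix x y assume "mult x a = mult y a"
      then have "mult (x - y) a = 0" by (simp add: mult_diff_left)
      with assms \<open>a \<noteq> 0\<close> show "x = y" by fastforce
    qed
    then show "bij (\<lambda>x. mult x a)"
      using fd.linear_inj_imp_surj[OF linear_mult_left] by (simp add: bij_def)
  qed
qed

end

lemma (in division_algebra) mult_eq_0_iff: "mult x y = 0 \<longleftrightarrow> x = 0 \<or> y = 0"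
  using bij_mult_left[of x] mult_zero_left mult_zero_right
  by (metis bij_pointE)

section \<open>Endomorphisms of a central division algebra as sums of two-sided
  multiplications\<close>

locale central_division_algebra =
  division_algebra smul "(*)" + finite_dimensional_vector_space smul E
  for smul :: "'f::field \<Rightarrow> 'b::ring_1 \<Rightarrow> 'b" and E :: "'b set" +
  assumes central: "{z. \<forall>x. z * x = x * z} = range (\<lambda>a. smul a 1)"
begin

lemma inverse_exists:
  fixes a :: 'b
  assumes "a \<noteq> 0"
  obtains b where "a * b = 1" "b * a = 1"
proof -
  obtain b where b: "a * b = 1"
    using bij_mult_left[OF assms] by (metis bij_pointE)
  obtain b' where b': "b' * a = 1"
    using bij_mult_right[OF assms] by (metis bij_pointE)
  have "b' = b"
    using b b' by (metis mult.assoc mult_1_left mult_1_right)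
  with b b' that show thesis by blast
qed

lemma basis_expansion: obtains r where "x = (\<Sum>e\<in>E. smul (r e) e)"
  using span_finite[OF finite_Basis] span_Basis by blast

text \<open>This is the image of the tensor product of \<open>B\<close> with its opposite algebra in
  the endomorphisms of \<open>B\<close>. Keeping the right factors in the basis \<open>E\<close>
  gives a normal form whose coefficients \<open>g\<close> can be compared.\<close>

definition mult_combination :: "('b \<Rightarrow> 'b) \<Rightarrow> bool" where
  "mult_combination T \<longleftrightarrow> (\<exists>g. \<forall>y. T y = (\<Sum>e\<in>E. g e * y * e))"

lemma mult_combination_add:
  assumes "mult_combination S" "mult_combination T"
  shows "mult_combination (\<lambda>y. S y + T y)"
proof -
  obtain g h where "\<forall>y. S y = (\<Sum>e\<in>E. g e * y * e)" "\<forall>y. T y = (\<Sum>e\<in>E. h e * y * e)"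
    using assms unfolding mult_combination_def by blast
  then have "\<forall>y. S y + T y = (\<Sum>e\<in>E. (g e + h e) * y * e)"
    by (simp add: algebra_simps sum.distrib)
  then show ?thesis unfolding mult_combination_def by (intro exI)
qed

lemma mult_combination_left:
  assumes "mult_combination T"
  shows "mult_combination (\<lambda>y. a * T y)"
proof -
  obtain g where "\<forall>y. T y = (\<Sum>e\<in>E. g e * y * e)"
    using assms unfolding mult_combination_def by blast
  then have "\<forall>y. a * T y = (\<Sum>e\<in>E. (a * g e) * y * e)"
    by (simp add: sum_distrib_left mult.assoc)
  then show ?thesis unfolding mult_combination_def by (intro exI)
qed

lemma mult_combination_diff:
  assumes "mult_combination S" "mult_combination T"
  shows "mult_combination (\<lambda>y. S y - T y)"
  using mult_combination_add[OF assms(1) mult_combination_left[OF assms(2), of "- 1"]] by simp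

lemma mult_combination_sum:
  assumes "\<And>i. i \<in> I \<Longrightarrow> mult_combination (T i)"
  shows "mult_combination (\<lambda>y. \<Sum>i\<in>I. T i y)"
proof -
  have zero: "mult_combination (\<lambda>y. 0)"
    unfolding mult_combination_def by (rule exI[of _ "\<lambda>_. 0"]) simp
  show ?thesis
    using assms
  proof (induction I rule: infinite_finite_induct)
    case (insert i I)
    then show ?case by (simp add: mult_combination_add)
  qed (simp_all add: zero)
qed

text \<open>The scalar coordinates of \<open>q\<close> in the basis move across \<open>y\<close>
  into the left factor.\<close>

lemma mult_combination_two_sided: "mult_combination (\<lambda>y. p * y * q)"
proof -
  obtain r where "q = (\<Sum>e\<in>E. smul (r e) e)" by (rule basis_expansion)
  then have "\<forall>y. p * y * q = (\<Sum>e\<in>E. smul (r e) p * y * e)"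
    by (simp add: sum_distrib_left mult_scale_left mult_scale_right)
  then show ?thesis unfolding mult_combination_def by (intro exI)
qed

lemma mult_combination_right:
  assumes "mult_combination T"
  shows "mult_combination (\<lambda>y. T y * b)"
proof -
  obtain g where "\<forall>y. T y = (\<Sum>e\<in>E. g e * y * e)"
    using assms unfolding mult_combination_def by blast
  then have "(\<lambda>y. T y * b) = (\<lambda>y. \<Sum>e\<in>E. g e * y * (e * b))"
    by (simp add: sum_distrib_right mult.assoc)
  then show ?thesis
    by (simp add: mult_combination_sum mult_combination_two_sided)
qed

text \<open>An instance of the density theorem, by induction on \<open>S\<close>: if every
  combination vanishing on \<open>S\<close> also vanished at the new vector \<open>x\<close>,
  centrality would force \<open>x\<close> into the span of \<open>S\<close>.\<close>

lemma dual_system: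
  assumes "finite S" "independent S"
  shows "\<exists>\<tau>. (\<forall>s\<in>S. mult_combination (\<tau> s)) \<and> (\<forall>s\<in>S. \<forall>t\<in>S. \<tau> s t = (if s = t then 1 else 0))"
  using assms
proof (induction S)
  case (insert x S)
  then have "independent S" and x: "x \<notin> span S"
    by (simp_all add: independent_insert)
  with insert.IH obtain \<tau> where \<tau>: "\<And>s. s \<in> S \<Longrightarrow> mult_combination (\<tau> s)"
    "\<And>s t. s \<in> S \<Longrightarrow> t \<in> S \<Longrightarrow> \<tau> s t = (if s = t then 1 else 0)"
    by blast
  have "\<exists>T. mult_combination T \<and> (\<forall>s\<in>S. T s = 0) \<and> T x \<noteq> 0"
  proof (rule ccontr)
    assume no: "\<not> ?thesis"
    \<comment> \<open>Under the assumption \<open>no\<close>, the value at \<open>x\<close> is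
      determined by the values on \<open>S\<close>: the error term \<open>U\<close> vanishes on
      \<open>S\<close>, hence at \<open>x\<close>.\<close>
    have interpolation: "T x = (\<Sum>s\<in>S. T s * \<tau> s x)" if T: "mult_combination T" for T
    proof -
      define U where "U y = T y - (\<Sum>s\<in>S. T s * \<tau> s y)" for y
      have "mult_combination U"
        unfolding U_def using T \<tau>(1)
        by (intro mult_combination_diff mult_combination_sum mult_combination_left)
      moreover have "U t = 0" if "t \<in> S" for t
      proof -
        have "(\<Sum>s\<in>S. T s * \<tau> s t) = (\<Sum>s\<in>S. if s = t then T s else 0)"
          using that by (intro sum.cong) (simp_all add: \<tau>(2))
        then show ?thesis
          using that \<open>finite S\<close> by (simp add: U_def)
      qed
      ultimately have "U x = 0" using no by blast
      then show ?thesis by (simp add: U_def)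
    qed
    have "\<exists>k. \<tau> s x = smul k 1" if s: "s \<in> S" for s
    proof -
      \<comment> \<open>Interpolate the map sending \<open>y\<close> to
        \<open>\<tau> s y * b\<close>: on \<open>S\<close> it is \<open>b\<close> at
        \<open>s\<close> and zero elsewhere. So \<open>\<tau> s x\<close> is central, hence a
        scalar.\<close>
      have "\<tau> s x * b = b * \<tau> s x" for b
      proof -
        have "\<tau> s x * b = (\<Sum>t\<in>S. \<tau> s t * b * \<tau> t x)"
          using interpolation[OF mult_combination_right[OF \<tau>(1)[OF s], of b]] .
        also have "\<dots> = (\<Sum>t\<in>S. if s = t then b * \<tau> t x else 0)"
          using s by (intro sum.cong) (simp_all add: \<tau>(2))
        finally show ?thesis using s \<open>finite S\<close> by simp
      qed
      then show ?thesis using central by blast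
    qed
    then obtain k where k: "\<And>s. s \<in> S \<Longrightarrow> \<tau> s x = smul (k s) 1" by metis
    \<comment> \<open>Interpolating the identity map now writes \<open>x\<close> as a linear
      combination of \<open>S\<close>.\<close>
    have "x = (\<Sum>s\<in>S. s * \<tau> s x)"
      using interpolation[of "\<lambda>y. y"] mult_combination_two_sided[of 1 1] by simp
    also have "\<dots> = (\<Sum>s\<in>S. smul (k s) s)"
      by (intro sum.cong) (simp_all add: k mult_scale_right)
    also have "\<dots> \<in> span S"
      by (intro span_sum span_scale span_base)
    finally show False using x by simp
  qed
  then obtain T where T: "mult_combination T" "\<And>s. s \<in> S \<Longrightarrow> T s = 0" "T x \<noteq> 0"
    by blast
  obtain b where b: "b * T x = 1" using inverse_exists[OF T(3)] by metis
  \<comment> \<open>The normalised \<open>b * T y\<close> is 1 at \<open>x\<close> and 0 on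
    \<open>S\<close>. Subtracting a multiple of it kills \<open>\<tau> s\<close> at \<open>x\<close>
    without changing its values on \<open>S\<close>.\<close>
  define \<tau>' where "\<tau>' = (\<lambda>s. if s = x then (\<lambda>y. b * T y) else (\<lambda>y. \<tau> s y - \<tau> s x * (b * T y)))"
  have "mult_combination (\<tau>' s)" if "s \<in> insert x S" for s
    using that T(1) \<tau>(1) by (auto simp: \<tau>'_def intro!: mult_combination_diff mult_combination_left)
  moreover have "\<tau>' s t = (if s = t then 1 else 0)" if "s \<in> insert x S" "t \<in> insert x S" for s t
    using that \<tau>(2) T(2) b \<open>x \<notin> S\<close> by (auto simp: \<tau>'_def)
  ultimately show ?case by blast
qed simp

text \<open>Weighting the dual system of the basis by the values \<open>f e\<close> gives a
  combination that agrees with \<open>f\<close> on the basis; both maps are linear.\<close>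

lemma linear_imp_mult_combination:
  assumes "Vector_Spaces.linear smul smul f"
  shows "mult_combination f"
proof -
  interpret f: Vector_Spaces.linear smul smul f by fact
  obtain \<tau> where \<tau>: "\<And>e. e \<in> E \<Longrightarrow> mult_combination (\<tau> e)"
    "\<And>e d. e \<in> E \<Longrightarrow> d \<in> E \<Longrightarrow> \<tau> e d = (if e = d then 1 else 0)"
    using dual_system[OF finite_Basis independent_Basis] by blast
  define h where "h y = (\<Sum>e\<in>E. f e * \<tau> e y)" for y
  have "mult_combination h"
    unfolding h_def using \<tau>(1) by (intro mult_combination_sum mult_combination_left)
  moreover have "f y = h y" for y
  proof -
    have lin_h: "Vector_Spaces.linear smul smul h"
    proof -
      obtain g where "\<forall>y. h y = (\<Sum>e\<in>E. g e * y * e)"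
        using \<open>mult_combination h\<close> unfolding mult_combination_def by blast
      then show ?thesis
        by (simp add: Vector_Spaces.linear_iff vector_space_axioms algebra_simps sum.distrib
            mult_scale_left mult_scale_right scale_sum_right)
    qed
    interpret h: Vector_Spaces.linear smul smul h by (fact lin_h)
    have "h d = f d" if "d \<in> E" for d
    proof -
      have "h d = (\<Sum>e\<in>E. if e = d then f e else 0)"
        unfolding h_def using that by (intro sum.cong) (simp_all add: \<tau>(2))
      then show ?thesis using that finite_Basis by simp
    qed
    moreover obtain r where "y = (\<Sum>e\<in>E. smul (r e) e)" by (rule basis_expansion)
    ultimately show ?thesis
      by (simp add: f.sum h.sum f.scale h.scale)
  qed
  ultimately show ?thesis by (metis ext)
qed

text \<open>The dual system isolates one coefficient: applying a combination \<open>\<tau>\<close>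
  to the right factors \<open>e\<close> alone turns the vanishing sum into the coefficient
  difference at \<open>d\<close>.\<close>

lemma mult_combination_unique:
  assumes "\<And>y. (\<Sum>e\<in>E. g e * y * e) = (\<Sum>e\<in>E. h e * y * e)" and "d \<in> E"
  shows "g d = h d"
proof -
  define a where "a e = g e - h e" for e
  have a: "(\<Sum>e\<in>E. a e * y * e) = 0" for y
    using assms(1)[of y] by (simp add: a_def algebra_simps sum_subtractf)
  obtain \<tau> where "mult_combination \<tau>" and \<tau>: "\<And>e. e \<in> E \<Longrightarrow> \<tau> e = (if e = d then 1 else 0)"
    using dual_system[OF finite_Basis independent_Basis] \<open>d \<in> E\<close> by metis
  then obtain p where p: "\<And>y. \<tau> y = (\<Sum>k\<in>E. p k * y * k)"
    unfolding mult_combination_def by blast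
  \<comment> \<open>Put \<open>y = p k\<close> in the vanishing sum, multiply by \<open>k\<close> on
    the right and sum over \<open>k\<close>. Exchanging the sums then collects
    \<open>\<tau> e\<close> behind each \<open>a e\<close>.\<close>
  have "0 = (\<Sum>k\<in>E. (\<Sum>e\<in>E. a e * p k * e) * k)" by (simp add: a)
  also have "\<dots> = (\<Sum>e\<in>E. a e * \<tau> e)"
    unfolding p sum_distrib_left sum_distrib_right by (subst sum.swap) (simp add: mult.assoc)
  also have "\<dots> = (\<Sum>e\<in>E. if e = d then a e else 0)"
    by (intro sum.cong) (simp_all add: \<tau>)
  also have "\<dots> = a d" using \<open>d \<in> E\<close> finite_Basis by simp
  finally show ?thesis by (simp add: a_def)
qed

section \<open>Automorphisms are inner and preserve multiplicative maps to a field\<close>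

theorem skolem_noether:
  assumes "algebra_automorphism smul \<sigma>"
  obtains a where "a \<noteq> 0" "\<And>x. \<sigma> x * a = a * x"
proof -
  have \<sigma>: "Vector_Spaces.linear smul smul \<sigma>" "\<sigma> 1 = 1" "\<And>x y. \<sigma> (x * y) = \<sigma> x * \<sigma> y"
    using assms by (auto simp: algebra_automorphism_def)
  obtain g where g: "\<And>y. \<sigma> y = (\<Sum>e\<in>E. g e * y * e)"
    using linear_imp_mult_combination[OF \<sigma>(1)] unfolding mult_combination_def by blast
  have "\<exists>d\<in>E. g d \<noteq> 0"
  proof (rule ccontr)
    assume "\<not> ?thesis"
    then have "\<sigma> 1 = 0" by (simp add: g)
    with \<sigma>(2) show False by simp
  qed
  then obtain d where d: "d \<in> E" "g d \<noteq> 0" by blast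
  have "\<sigma> x * g d = g d * x" for x
  proof (rule mult_combination_unique[of "\<lambda>e. \<sigma> x * g e" "\<lambda>e. g e * x", OF _ d(1)])
    fix y
    have "(\<Sum>e\<in>E. \<sigma> x * g e * y * e) = \<sigma> x * \<sigma> y"
      by (simp add: g[of y] sum_distrib_left mult.assoc)
    also have "\<dots> = \<sigma> (x * y)" by (simp add: \<sigma>(3))
    also have "\<dots> = (\<Sum>e\<in>E. g e * x * y * e)" by (simp add: g mult.assoc)
    finally show "(\<Sum>e\<in>E. \<sigma> x * g e * y * e) = (\<Sum>e\<in>E. g e * x * y * e)" .
  qed
  with d(2) that show thesis by blast
qed

text \<open>A multiplicative map to a field does not distinguish conjugates: \<open>N a\<close> is
  nonzero because \<open>a\<close> is invertible, so it cancels.\<close>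

lemma multiplicative_automorphism_invariant:
  fixes N :: "'b \<Rightarrow> 'c::field"
  assumes "N 1 = 1" "\<And>x y. N (x * y) = N x * N y" and "algebra_automorphism smul \<sigma>"
  shows "N (\<sigma> x) = N x"
proof -
  obtain a where a: "a \<noteq> 0" "\<sigma> x * a = a * x"
    using skolem_noether[OF assms(3)] by metis
  obtain b where "a * b = 1" using inverse_exists[OF a(1)] by metis
  then have "N a * N b = 1" by (metis assms(1,2))
  then have "N a \<noteq> 0" by auto
  moreover have "N (\<sigma> x) * N a = N a * N x" by (metis a(2) assms(2))
  ultimately show ?thesis by simp
qed

text \<open>
  The three doublings differ only in the bilinear term \<open>f v y\<close>, which is \<open>c \<sigma>(v y)\<close>,
  \<open>\<sigma>(v) c \<sigma>(y)\<close> or \<open>\<sigma>(v y) c\<close>.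
\<close>

lemma doubling_division_algebra:
  fixes N :: "'b \<Rightarrow> 'c::field"
  assumes N: "N 1 = 1" "\<And>x y. N (x * y) = N x * N y"
    and c: "\<And>a. N c \<noteq> (N a)\<^sup>2"
    and f_right: "\<And>v. Vector_Spaces.linear smul smul (f v)"
    and f_left: "\<And>y. Vector_Spaces.linear smul smul (\<lambda>v. f v y)"
    and f_norm: "\<And>v y. N (f v y) = N c * N v * N y"
  shows "division_algebra (module_prod.scale smul smul)
           (\<lambda>(u, v) (x, y). (u * x + f v y, u * y + v * x))"
proof -
  interpret P: finite_dimensional_vector_space_prod smul smul E E by unfold_locales
  define m where "m = (\<lambda>(u, v) (x, y). (u * x + f v y, u * y + v * x))"
  have "finite_dimensional_vector_space P.scale P.Basis_pair" by unfold_locales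
  have f_add: "f v (x + y) = f v x + f v y" "f (v + u) x = f v x + f u x"
    and f_scale: "f v (smul r x) = smul r (f v x)" "f (smul r v) x = smul r (f v x)" for u v x y r
    using f_right[of v] f_left[of x] by (auto simp: Vector_Spaces.linear_iff)
  have f_0: "f v 0 = 0" "f 0 y = 0" for v y
    using f_scale(1)[of v 0 0] f_scale(2)[of 0 0 y] by simp_all
  interpret D: finite_dim_algebra P.scale m
  proof (intro finite_dim_algebra.intro finite_dim_algebra_axioms.intro)
    show "vector_space P.scale" by (fact P.p.vector_space_axioms)
  next
    show "\<exists>B. finite_dimensional_vector_space P.scale B"
      using \<open>finite_dimensional_vector_space P.scale P.Basis_pair\<close> by blast
  next
    fix p
    show "Vector_Spaces.linear P.scale P.scale (\<lambda>q. m p q)"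
      by (auto simp: Vector_Spaces.linear_iff P.p.vector_space_axioms m_def P.scale_prod
          f_add f_scale algebra_simps mult_scale_right split: prod.splits)
  next
    fix q
    show "Vector_Spaces.linear P.scale P.scale (\<lambda>p. m p q)"
      by (auto simp: Vector_Spaces.linear_iff P.p.vector_space_axioms m_def P.scale_prod
          f_add f_scale algebra_simps mult_scale_left split: prod.splits)
  qed
  \<comment> \<open>Otherwise \<open>N 0 = N 0 * N c\<close> would give \<open>N c = 1\<close>,
    which is the excluded square of \<open>N 1\<close>.\<close>
  have N_0: "N 0 = 0"
    using N(2)[of 0 c] N(1) c[of 1] by auto
  have N_eq_0: "x = 0" if "N x = 0" for x
  proof (rule ccontr)
    assume "x \<noteq> 0"
    then obtain b where "x * b = 1" using inverse_exists by metis
    then have "N x * N b = 1" by (metis N)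
    with that show False by simp
  qed
  have "division_algebra P.scale m"
  proof (rule D.division_algebraI)
    fix p q assume pq: "m p q = 0"
    obtain u v x y where p: "p = (u, v)" and q: "q = (x, y)" by fastforce
    have 1: "u * x + f v y = 0" and 2: "u * y + v * x = 0"
      using pq by (simp_all add: m_def p q zero_prod_def)
    show "p = 0 \<or> q = 0"
    proof (cases "y = 0")
      case True
      with 1 2 show ?thesis by (auto simp: p q zero_prod_def f_0 mult_eq_0_iff)
    next
      case False
      obtain w where x: "x = w * y"
        using bij_mult_right[OF False] by (metis bij_pointE)
      have "(u + v * w) * y = 0"
        using 2 by (simp add: x algebra_simps)
      with False have u: "u = - (v * w)"
        by (simp add: mult_eq_0_iff eq_neg_iff_add_eq_0)
      have "f v y = v * w * w * y"
        using 1 by (simp add: u x mult.assoc)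
      \<comment> \<open>Norms commute, so the order of the factors inside \<open>f v y\<close> no
        longer matters, and the two occurrences of \<open>w\<close> form the excluded
        square.\<close>
      then have "N c * N v * N y = N v * N w * N w * N y"
        by (metis f_norm N(2))
      with c[of w] have "N v = 0 \<or> N y = 0"
        by (auto simp: power2_eq_square)
      with False have "v = 0" using N_eq_0 by blast
      with u show ?thesis by (simp add: p zero_prod_def)
    qed
  qed
  then show ?thesis unfolding m_def .
qed

end

section \<open>The reduced norm and the three doublings\<close>

lemma is_reduced_norm_multiplicative:
  assumes "is_reduced_norm smul N"
  shows "N 1 = 1" "N (x * y) = N x * N y"
proof -
  obtain n \<phi> where \<phi>: "splitting smul n \<phi>" and N: "\<And>x. to_ac (N x) = det (\<phi> x)"
    using assms unfolding is_reduced_norm_def by blast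
  have car: "\<phi> z \<in> carrier_mat n n" for z
    using \<phi> by (simp add: splitting_def)
  \<comment> \<open>Both identities are checked on determinants over the algebraic closure and
    pulled back along the injective \<open>to_ac\<close>.\<close>
  have "to_ac (N 1) = to_ac 1"
    using \<phi> by (simp only: N) (simp add: splitting_def)
  then show "N 1 = 1" by (simp only: to_ac_eq_iff)
  have "to_ac (N (x * y)) = to_ac (N x * N y)"
    using \<phi> det_mult[OF car car] by (simp add: N splitting_def)
  then show "N (x * y) = N x * N y" by (simp only: to_ac_eq_iff)
qed

theorem corollary3p9:
  fixes smul :: "'f::field \<Rightarrow> 'b::ring_1 \<Rightarrow> 'b"
    and N :: "'b \<Rightarrow> 'f"
    and \<sigma> :: "'b \<Rightarrow> 'b"
    and c :: 'b
  assumes "central_simple_algebra smul"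
    and "division_algebra smul ((*) :: 'b \<Rightarrow> 'b \<Rightarrow> 'b)"
    and "is_reduced_norm smul N"
    and "algebra_automorphism smul \<sigma>"
    and "\<sigma> \<noteq> id"
    and "\<exists>d. c * d = 1 \<and> d * c = 1"
    and "\<And>a. N c \<noteq> (N a)\<^sup>2"
  shows "division_algebra (module_prod.scale smul smul) (mult_D \<sigma> c)
       \<and> division_algebra (module_prod.scale smul smul) (mult_D\<^sub>m \<sigma> c)
       \<and> division_algebra (module_prod.scale smul smul) (mult_D\<^sub>r \<sigma> c)"
proof -
  interpret B: division_algebra smul "(*)" by fact
  obtain E where "finite_dimensional_vector_space smul E"
    using B.finite_dim by blast
  then interpret B: central_division_algebra smul E
    using assms(1) central_simple_algebra.central
    by (intro central_division_algebra.intro central_division_algebra_axioms.intro assms(2))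
  note N = is_reduced_norm_multiplicative[OF assms(3)]
  have N_\<sigma>: "N (\<sigma> x) = N x" for x
    using B.multiplicative_automorphism_invariant[OF N assms(4)] .
  have \<sigma>: "\<sigma> (x + y) = \<sigma> x + \<sigma> y" "\<sigma> (smul r x) = smul r (\<sigma> x)" "\<sigma> (x * y) = \<sigma> x * \<sigma> y" for x y r
    using assms(4) by (auto simp: algebra_automorphism_def Vector_Spaces.linear_iff)
  note lin = Vector_Spaces.linear_iff B.vector_space_axioms \<sigma> algebra_simps
    B.mult_scale_left B.mult_scale_right
  \<comment> \<open>In all three cases unification reads the term \<open>f\<close> off the unfolded
    multiplication. Its norm is \<open>N c * N v * N y\<close>, since \<open>N\<close> is
    multiplicative with commuting values and invariant under \<sigma>.\<close>
  have "division_algebra (module_prod.scale smul smul) (mult_D \<sigma> c)"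
    unfolding mult_D_def
    by (rule B.doubling_division_algebra[OF N assms(7)]) (simp_all add: lin N N_\<sigma>)
  moreover have "division_algebra (module_prod.scale smul smul) (mult_D\<^sub>m \<sigma> c)"
    unfolding mult_D\<^sub>m_def
    by (rule B.doubling_division_algebra[OF N assms(7)]) (simp_all add: lin N N_\<sigma>)
  moreover have "division_algebra (module_prod.scale smul smul) (mult_D\<^sub>r \<sigma> c)"
    unfolding mult_D\<^sub>r_def
    by (rule B.doubling_division_algebra[OF N assms(7)]) (simp_all add: lin N N_\<sigma>)
  ultimately show ?thesis by blast
qed

end
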